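(* Let $(\mathcal{A},\Omega)$ be a symmetric commutative (i.e. $\mathcal{A}$ is commutative) abstract $O^*$-algebra. Then $\mathcal{S}_{\mathrm{p}}(\mathcal{A},\Omega) = \mathcal{M}(\mathcal{A},\Omega)$, i.e. the pure states of $(\mathcal{A},\Omega)$ are precisely its characters.
   Context: All $^*$-algebras are associative, unital (unit $\mathbb{1}$) and over $\mathbb{C}$. For a $^*$-algebra $\mathcal{A}$, $\mathcal{A}_{\mathrm H}:=\{a\in\mathcal{A} : a=a^*\}$. A quasi-ordered $^*$-algebra is a $^*$-algebra $\mathcal{A}$ with a reflexive and transitive relation $\lesssim$ on $\mathcal{A}_{\mathrm H}$ such that for all $a,b\in\mathcal{A}_{\mathrm H}$ with $a\lesssim b$, all $c\in\mathcal{A}_{\mathrm H}$, $d\in\mathcal{A}$: $a+c\lesssim b+c$, $d^*ad\lesssim d^*bd$, and $0\lesssim\mathbb{1}$. Put $\mathcal{A}^+_{\mathrm H}:=\{a\in\mathcal{A}_{\mathrm H} : 0\lesssim a\}$. $\mathcal{A}^*$ is the space of all linear functionals $\mathcal{A}\to\mathbb{C}$, with dual pairing $\langle\omega,a\rangle$. For $\omega\in\mathcal{A}^*$ and $a,b,c\in\mathcal{A}$: $\langle\omega^*,a\rangle:=\overline{\langle\omega,a^*\rangle}$; $\langle b\cdot\omega\cdot c,a\rangle:=\langle\omega,cab\rangle$ (an $\mathcal{A}$-bimodule structure). Put $\mathcal{A}^*_{\mathrm H}:=\{\omega : \omega^*=\omega\}$, partially ordered by $\omega\le\rho$ iff $\langle\omega,a\rangle\le\langle\rho,a\rangle$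 for all $a\in\mathcal{A}^+_{\mathrm H}$, and $\mathcal{A}^{*,+}_{\mathrm H}:=\{\omega\in\mathcal{A}^*_{\mathrm H} : \omega\ge0\}$. An abstract $O^*$-algebra is a pair $(\mathcal{A},\Omega)$ of a quasi-ordered $^*$-algebra $\mathcal{A}$ and a linear subspace and $\mathcal{A}$-subbimodule $\Omega\subseteq\mathcal{A}^*$ stable under $\omega\mapsto\omega^*$ such that, with $\Omega_{\mathrm H}:=\Omega\cap\mathcal{A}^*_{\mathrm H}$ and $\Omega^+_{\mathrm H}:=\Omega\cap\mathcal{A}^{*,+}_{\mathrm H}$, $\Omega$ is the linear span of $\Omega^+_{\mathrm H}$ and $\mathcal{A}^+_{\mathrm H}=\{a\in\mathcal{A}_{\mathrm H} : \langle\omega,a\rangle\ge0\text{ for all }\omega\in\Omega^+_{\mathrm H}\}$. States: $\mathcal{S}(\mathcal{A},\Omega):=\{\omega\in\Omega^+_{\mathrm H} : \langle\omega,\mathbb{1}\rangle=1\}$; pure states: $\mathcal{S}_{\mathrm p}(\mathcal{A},\Omega)$ is the set of extreme points of the convex set $\mathcal{S}(\mathcal{A},\Omega)$; characters: $\mathcal{M}(\mathcal{A},\Omega)$ is the set of $\omega\in\mathcal{S}(\mathcal{A},\Omega)$ with $\langle\omega,ab\rangle=\langle\omega,a\rangle\langle\omega,b\rangle$ for all $a,b\in\mathcal{A}$. $(\mathcal{A},\Omega)$ is symmetric if for every $a\in\mathcal{A}_{\mathrm H}$ there exists a multiplicative inverse of $\mathbb{1}+a^2$ in $\mathcal{A}$.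 *)

theory Defs
  imports
    "HOL-Analysis.Analysis"
    "HOL-Library.Function_Algebras"
    "HOL-Library.Complex_Order"
begin

text \<open>Linear functionals are plain functions with pointwise operations. The real vector space
  structure on function types makes \<^const>\<open>extreme_point_of\<close> applicable to sets of functionals.\<close>

instantiation "fun" :: (type, real_vector) real_vector
begin

definition scaleR_fun :: "real \<Rightarrow> ('a \<Rightarrow> 'b) \<Rightarrow> 'a \<Rightarrow> 'b" where
  "scaleR_fun r f = (\<lambda>x. r *\<^sub>R f x)"

instance
  by standard (simp_all add: scaleR_fun_def fun_eq_iff scaleR_add_right scaleR_add_left)

end

definition scaleC_functional :: "complex \<Rightarrow> ('a \<Rightarrow> complex) \<Rightarrow> 'a \<Rightarrow> complex" where
  "scaleC_functional c \<omega> = (\<lambda>a. c * \<omega> a)"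

global_interpretation functional: vector_space "scaleC_functional :: complex \<Rightarrow> ('a \<Rightarrow> complex) \<Rightarrow> _"
  by standard (simp_all add: scaleC_functional_def fun_eq_iff algebra_simps)

text \<open>The sort \<^emph>\<open>ring, monoid_mult\<close> is that of unital associative rings that may be the zero
  ring; the class \<^class>\<open>ring_1\<close> would impose \<^prop>\<open>(0::'a::ring_1) \<noteq> 1\<close>.\<close>

locale star_algebra =
  vector_space scale
  for scale :: "complex \<Rightarrow> 'a::{ring, monoid_mult} \<Rightarrow> 'a" (infixr \<open>*\<^sub>C\<close> 75) +
  fixes star :: "'a \<Rightarrow> 'a"
  assumes scale_mult_left: "(c *\<^sub>C a) * b = c *\<^sub>C (a * b)"
    and scale_mult_right: "a * (c *\<^sub>C b) = c *\<^sub>C (a * b)"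
    and star_add: "star (a + b) = star a + star b"
    and star_scale: "star (c *\<^sub>C a) = cnj c *\<^sub>C star a"
    and star_mult: "star (a * b) = star b * star a"
    and star_star: "star (star a) = a"
begin

definition herm :: "'a set" where
  "herm = {a. star a = a}"

definition dual :: "('a \<Rightarrow> complex) set" where
  "dual = {\<omega>. Vector_Spaces.linear scale (*) \<omega>}"

definition dual_star :: "('a \<Rightarrow> complex) \<Rightarrow> 'a \<Rightarrow> complex" where
  "dual_star \<omega> = (\<lambda>a. cnj (\<omega> (star a)))"

definition dual_act :: "'a \<Rightarrow> ('a \<Rightarrow> complex) \<Rightarrow> 'a \<Rightarrow> 'a \<Rightarrow> complex" where
  "dual_act b \<omega> c = (\<lambda>a. \<omega> (c * a * b))"

definition dual_herm :: "('a \<Rightarrow> complex) set" where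
  "dual_herm = {\<omega> \<in> dual. dual_star \<omega> = \<omega>}"

end

text \<open>The quasi-order is a relation on hermitian elements only: the values of \<^emph>\<open>le\<close> on other
  arguments are unconstrained and are never used.\<close>

locale quasi_ordered_star_algebra = star_algebra scale star
  for scale :: "complex \<Rightarrow> 'a::{ring, monoid_mult} \<Rightarrow> 'a" (infixr \<open>*\<^sub>C\<close> 75)
    and star :: "'a \<Rightarrow> 'a" +
  fixes le :: "'a \<Rightarrow> 'a \<Rightarrow> bool" (infix \<open>\<preceq>\<close> 50)
  assumes le_reflp: "reflp_on herm (\<preceq>)"
    and le_transp: "transp_on herm (\<preceq>)"
    and le_add: "\<lbrakk>a \<in> herm; b \<in> herm; c \<in> herm; a \<preceq> b\<rbrakk> \<Longrightarrow> a + c \<preceq> b + c"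
    and le_conj: "\<lbrakk>a \<in> herm; b \<in> herm; a \<preceq> b\<rbrakk> \<Longrightarrow> star d * a * d \<preceq> star d * b * d"
    and zero_le_one: "0 \<preceq> 1"
begin

definition pos :: "'a set" where
  "pos = {a \<in> herm. 0 \<preceq> a}"

text \<open>The inequality is the order of \<^typ>\<open>complex\<close>, in which comparable numbers have equal
  imaginary parts; values of hermitian functionals on hermitian elements are real.\<close>

definition dual_le :: "('a \<Rightarrow> complex) \<Rightarrow> ('a \<Rightarrow> complex) \<Rightarrow> bool" where
  "dual_le \<omega> \<rho> \<longleftrightarrow> (\<forall>a\<in>pos. \<omega> a \<le> \<rho> a)"

definition dual_pos :: "('a \<Rightarrow> complex) set" where
  "dual_pos = {\<omega> \<in> dual_herm. dual_le 0 \<omega>}"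

end

locale abstract_Ostar_algebra = quasi_ordered_star_algebra scale star le
  for scale :: "complex \<Rightarrow> 'a::{ring, monoid_mult} \<Rightarrow> 'a" (infixr \<open>*\<^sub>C\<close> 75)
    and star :: "'a \<Rightarrow> 'a"
    and le :: "'a \<Rightarrow> 'a \<Rightarrow> bool" (infix \<open>\<preceq>\<close> 50) +
  fixes \<Omega> :: "('a \<Rightarrow> complex) set"
  assumes Omega_dual: "\<Omega> \<subseteq> dual"
    and Omega_subspace: "functional.subspace \<Omega>"
    and Omega_act: "\<omega> \<in> \<Omega> \<Longrightarrow> dual_act b \<omega> c \<in> \<Omega>"
    and Omega_star: "\<omega> \<in> \<Omega> \<Longrightarrow> dual_star \<omega> \<in> \<Omega>"
    and Omega_span: "\<Omega> = functional.span (\<Omega> \<inter> dual_pos)"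
    and pos_eq: "pos = {a \<in> herm. \<forall>\<omega>\<in>\<Omega> \<inter> dual_pos. 0 \<le> \<omega> a}"
begin

definition states :: "('a \<Rightarrow> complex) set" where
  "states = {\<omega> \<in> \<Omega> \<inter> dual_pos. \<omega> 1 = 1}"

definition pure_states :: "('a \<Rightarrow> complex) set" where
  "pure_states = {\<omega>. \<omega> extreme_point_of states}"

definition characters :: "('a \<Rightarrow> complex) set" where
  "characters = {\<omega> \<in> states. \<forall>a b. \<omega> (a * b) = \<omega> a * \<omega> b}"

definition symmetric :: bool where
  "symmetric \<longleftrightarrow> (\<forall>a\<in>herm. \<exists>b. (1 + a\<^sup>2) * b = 1 \<and> b * (1 + a\<^sup>2) = 1)"

end

end

theory Submission
  imports Defs
begin

text \<open>
  A character \<open>\<omega>\<close> has no variance: \<open>\<omega> (b * b) = 0\<close> for hermitian \<open>b = a - \<omega> a\<close>. If \<open>\<omega>\<close> is a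
  proper convex combination of two states, then both of them vanish on \<open>b * b\<close> as well, hence on
  \<open>b\<close> by the Cauchy-Schwarz inequality, and so both agree with \<open>\<omega>\<close> on \<open>a\<close>. Thus \<open>\<omega>\<close> is extreme.

  Conversely, let \<open>\<omega>\<close> be a pure state. Every decomposition of \<open>\<omega>\<close> into two positive functionals of
  \<open>\<Omega>\<close> consists of multiples of \<open>\<omega>\<close> (lemma \<open>pure_summand_proportional\<close>). Symmetry provides such
  decompositions: although \<open>a\<close> may be unbounded, the inverse \<open>r\<close> of \<open>1 + a * a\<close> satisfies
  \<open>0 \<le> r \<le> 1\<close> in the strong sense that
  \<open>r = r * r + (a * r) * (a * r)\<close> and \<open>1 - r = (a * r) * (a * r) + (a * a * r) * (a * a * r)\<close>.
  Products of positive elements need not be positive in a quasi-ordered \<open>*\<close>-algebra, but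
  multiplication by a sum of squares does preserve positivity, so \<open>b \<mapsto> \<omega> (r * b)\<close> and
  \<open>b \<mapsto> \<omega> ((1 - r) * b)\<close> are positive functionals with sum \<open>\<omega>\<close>. Therefore
  \<open>\<omega> (r * b) = \<omega> r * \<omega> b\<close>. Substituting \<open>(1 + a * a) * b\<close> for \<open>b\<close> transfers this identity from \<open>r\<close>
  to \<open>1 + a * a\<close>; completing the square transfers it to all hermitian elements, and linearity to
  the whole algebra.
\<close>

section \<open>Hermitian elements and hermitian functionals\<close>

context star_algebra
begin

lemma star_zero: "star 0 = 0"
  using star_add[of 0 0] by simp

lemma star_one: "star 1 = 1"
  by (metis star_mult star_star mult_1_left mult_1_right)

lemma star_diff: "star (a - b) = star a - star b"
  using star_add[of "a - b" b] by (simp add: eq_diff_eq)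

lemma herm_zero: "0 \<in> herm"
  and herm_one: "1 \<in> herm"
  and herm_add: "a \<in> herm \<Longrightarrow> b \<in> herm \<Longrightarrow> a + b \<in> herm"
  and herm_diff: "a \<in> herm \<Longrightarrow> b \<in> herm \<Longrightarrow> a - b \<in> herm"
  and herm_scale: "a \<in> herm \<Longrightarrow> of_real x *\<^sub>C a \<in> herm"
  by (simp_all add: herm_def star_zero star_one star_add star_diff star_scale)

lemma cartesian_decomposition:
  obtains h k where "h \<in> herm" "k \<in> herm" "a = h + \<i> *\<^sub>C k"
proof
  show "(1/2) *\<^sub>C (a + star a) \<in> herm"
    by (simp add: herm_def star_add star_scale star_star add.commute)
  show "(\<i>/2) *\<^sub>C (star a - a) \<in> herm"
    by (simp add: herm_def star_add star_diff star_scale star_star scale_right_diff_distrib)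
  have "(1/2) *\<^sub>C (a + star a) + \<i> *\<^sub>C ((\<i>/2) *\<^sub>C (star a - a))
      = (1/2) *\<^sub>C a + (1/2) *\<^sub>C a"
    by (simp add: scale_right_distrib scale_right_diff_distrib scale_minus_left)
  also have "\<dots> = a"
    by (simp flip: scale_left_distrib)
  finally show "a = (1/2) *\<^sub>C (a + star a) + \<i> *\<^sub>C ((\<i>/2) *\<^sub>C (star a - a))"
    by simp
qed

lemma dual_add: "f \<in> dual \<Longrightarrow> f (a + b) = f a + f b"
  and dual_scale: "f \<in> dual \<Longrightarrow> f (c *\<^sub>C a) = c * f a"
  by (simp_all add: dual_def Vector_Spaces.linear_iff)

lemma dual_diff: "f \<in> dual \<Longrightarrow> f (a - b) = f a - f b"
  using dual_add[of f "a - b" b] by (simp add: eq_diff_eq)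

lemma dual_eqI:
  assumes "f \<in> dual" "g \<in> dual" "\<And>a. a \<in> herm \<Longrightarrow> f a = g a"
  shows "f = g"
proof
  fix a
  obtain h k where "h \<in> herm" "k \<in> herm" "a = h + \<i> *\<^sub>C k"
    by (rule cartesian_decomposition)
  with assms show "f a = g a"
    by (simp add: dual_add dual_scale)
qed

lemma dual_herm_real:
  assumes "f \<in> dual_herm" "a \<in> herm"
  shows "f a = of_real (Re (f a))"
proof -
  have "dual_star f a = f a"
    using assms by (simp add: dual_herm_def)
  then have "cnj (f a) = f a"
    using assms by (simp add: dual_star_def herm_def)
  then show ?thesis
    by (metis Reals_cnj_iff of_real_Re)
qed

end

section \<open>Positive functionals\<close>

context quasi_ordered_star_algebra
begin

lemma dual_posD:
  assumes "f \<in> dual_pos"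
  shows "f \<in> dual" "f \<in> dual_herm" "a \<in> pos \<Longrightarrow> 0 \<le> f a"
  using assms by (auto simp: dual_pos_def dual_herm_def dual_le_def)

lemma conj_pos:
  assumes "a \<in> pos"
  shows "star d * a * d \<in> pos"
  using assms le_conj[of 0 a d] herm_zero
  by (simp add: pos_def herm_def star_mult star_star mult.assoc)

lemma one_pos: "1 \<in> pos"
  by (simp add: pos_def herm_one zero_le_one)

lemma square_pos:
  assumes "b \<in> herm"
  shows "b * b \<in> pos"
  using conj_pos[OF one_pos, of b] assms by (simp add: herm_def)

lemma dual_pos_add:
  assumes "f \<in> dual_pos" "g \<in> dual_pos"
  shows "f + g \<in> dual_pos"
proof -
  have "0 \<le> f a + g a" if "a \<in> pos" for a
    using dual_posD(3)[OF assms(1) that] dual_posD(3)[OF assms(2) that] by (rule add_nonneg_nonneg)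
  with assms show ?thesis
    by (auto simp: dual_pos_def dual_herm_def dual_def dual_star_def dual_le_def
        Vector_Spaces.linear_iff fun_eq_iff algebra_simps)
qed

lemma dual_pos_scale:
  assumes "f \<in> dual_pos" "0 \<le> x"
  shows "scaleC_functional (of_real x) f \<in> dual_pos"
proof -
  have "0 \<le> of_real x * f a" if "a \<in> pos" for a
    using dual_posD(3)[OF assms(1) that] assms(2) by (simp add: less_eq_complex_def)
  with assms show ?thesis
    by (auto simp: dual_pos_def dual_herm_def dual_def dual_star_def dual_le_def
        scaleC_functional_def Vector_Spaces.linear_iff fun_eq_iff algebra_simps)
qed

lemma dual_pos_conj:
  assumes "f \<in> dual_pos"
  shows "dual_act d f (star d) \<in> dual_pos"
proof -
  have "dual_act d f (star d) \<in> dual"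
    using dual_posD(1)[OF assms]
    by (simp add: dual_def dual_act_def Vector_Spaces.linear_iff distrib_left distrib_right
        scale_mult_left scale_mult_right)
  moreover have "dual_star (dual_act d f (star d)) = dual_act d f (star d)"
  proof
    fix a
    have "dual_star f (star d * a * d) = f (star d * a * d)"
      using dual_posD(2)[OF assms] by (simp add: dual_herm_def)
    then show "dual_star (dual_act d f (star d)) a = dual_act d f (star d) a"
      by (simp add: dual_star_def dual_act_def star_mult star_star mult.assoc)
  qed
  moreover have "0 \<le> dual_act d f (star d) a" if "a \<in> pos" for a
    using dual_posD(3)[OF assms conj_pos[OF that]] by (simp add: dual_act_def)
  ultimately show ?thesis
    by (simp add: dual_pos_def dual_herm_def dual_le_def)
qed

text \<open>The nonnegative quadratic polynomial \<open>s \<mapsto> f ((b + s) * (b + s))\<close> of the real variable \<open>s\<close>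
  has a nonpositive discriminant. If \<open>f 1 = 0\<close>, it has degree at most 1, and is then constant.\<close>

lemma Cauchy_Schwarz_herm:
  assumes f: "f \<in> dual_pos" and b: "b \<in> herm"
  shows "(Re (f b))\<^sup>2 \<le> Re (f 1) * Re (f (b * b))"
proof -
  define A B C where "A = Re (f 1)" and "B = Re (f b)" and "C = Re (f (b * b))"
  note [simp] = dual_add[OF dual_posD(1)[OF f]] dual_scale[OF dual_posD(1)[OF f]]
  have quad: "0 \<le> C + 2 * s * B + s\<^sup>2 * A" for s
  proof -
    let ?b = "b + of_real s *\<^sub>C 1"
    have "?b \<in> herm"
      by (intro herm_add herm_scale herm_one b)
    from dual_posD(3)[OF f square_pos[OF this]] have "0 \<le> Re (f (?b * ?b))"
      by (simp add: less_eq_complex_def)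
    then show ?thesis
      by (simp add: distrib_left distrib_right scale_mult_left scale_mult_right
          A_def B_def C_def power2_eq_square algebra_simps)
  qed
  have "0 \<le> A"
    using dual_posD(3)[OF f one_pos] by (simp add: A_def less_eq_complex_def)
  then consider "A = 0" | "A > 0"
    by linarith
  then have "B\<^sup>2 \<le> A * C"
  proof cases
    case 1
    have "B = 0"
    proof (rule ccontr)
      assume "B \<noteq> 0"
      then show False
        using quad[of "- (C + 1) / (2 * B)"] 1 by (simp add: field_simps)
    qed
    with 1 show ?thesis by simp
  next
    case 2
    have "0 \<le> A * (C + 2 * (- B / A) * B + (- B / A)\<^sup>2 * A)"
      using quad[of "- B / A"] 2 by simp
    also have "\<dots> = A * C - B\<^sup>2"
      using 2 by (simp add: field_simps power2_eq_square)
    finally show ?thesis by simp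
  qed
  then show ?thesis
    by (simp add: A_def B_def C_def)
qed

lemma dual_pos_vanish:
  assumes f: "f \<in> dual_pos" and b: "b \<in> herm" and null: "f 1 = 0 \<or> f (b * b) = 0"
  shows "f b = 0"
proof -
  have "(Re (f b))\<^sup>2 \<le> 0"
    using Cauchy_Schwarz_herm[OF f b] null by auto
  then have "Re (f b) = 0"
    by simp
  then show ?thesis
    using dual_herm_real[OF dual_posD(2)[OF f] b] by simp
qed

lemma dual_pos_eq_zero:
  assumes "f \<in> dual_pos" "f 1 = 0"
  shows "f = 0"
proof (rule dual_eqI)
  show "f \<in> dual"
    by (rule dual_posD(1)[OF assms(1)])
  show "0 \<in> dual"
    using dual_posD(1)[OF dual_pos_scale[OF assms(1), of 0]] by simp
qed (use assms dual_pos_vanish in auto)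

end

section \<open>Characters are pure\<close>

context abstract_Ostar_algebra
begin

lemma statesD:
  assumes "\<omega> \<in> states"
  shows "\<omega> \<in> \<Omega>" "\<omega> \<in> dual_pos" "\<omega> \<in> dual" "\<omega> 1 = 1"
  using assms dual_posD(1) by (auto simp: states_def)

lemma character_eq_convex_part:
  assumes \<omega>: "\<omega> \<in> characters" and \<rho>: "\<rho> \<in> states" and \<sigma>: "\<sigma> \<in> states"
    and u: "0 < u" "u \<le> 1" and comb: "\<And>a. \<omega> a = of_real u * \<rho> a + of_real (1 - u) * \<sigma> a"
  shows "\<rho> = \<omega>"
proof (rule dual_eqI)
  have \<omega>s: "\<omega> \<in> states" and mult: "\<And>a b. \<omega> (a * b) = \<omega> a * \<omega> b"
    using \<omega> by (auto simp: characters_def)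
  show "\<rho> \<in> dual" "\<omega> \<in> dual"
    using statesD \<rho> \<omega>s by auto
  fix a assume a: "a \<in> herm"
  define b where "b = a - of_real (Re (\<omega> a)) *\<^sub>C 1"
  have b: "b \<in> herm"
    unfolding b_def by (intro herm_diff herm_scale herm_one a)
  have \<omega>a: "\<omega> a = of_real (Re (\<omega> a))"
    by (rule dual_herm_real[OF dual_posD(2)[OF statesD(2)[OF \<omega>s]] a])
  then have "\<omega> b = 0"
    using statesD[OF \<omega>s] by (simp add: b_def dual_diff dual_scale)
  then have "of_real u * \<rho> (b * b) + of_real (1 - u) * \<sigma> (b * b) = 0"
    using comb[of "b * b"] mult[of b b] by simp
  moreover have "0 \<le> \<rho> (b * b)" "0 \<le> \<sigma> (b * b)"
    using dual_posD(3)[OF statesD(2)] \<rho> \<sigma> square_pos[OF b] by auto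
  ultimately have "\<rho> (b * b) = 0"
    using u by (auto simp: complex_eq_iff less_eq_complex_def add_nonneg_eq_0_iff)
  then have "\<rho> b = 0"
    by (intro dual_pos_vanish statesD(2) \<rho> b) simp
  then have "\<rho> a = of_real (Re (\<omega> a))"
    using statesD[OF \<rho>] by (simp add: b_def dual_diff dual_scale)
  with \<omega>a show "\<rho> a = \<omega> a"
    by simp
qed

lemma characters_subset_pure_states: "characters \<subseteq> pure_states"
proof
  fix \<omega> assume \<omega>: "\<omega> \<in> characters"
  have "\<omega> \<notin> open_segment \<rho> \<sigma>" if \<rho>: "\<rho> \<in> states" and \<sigma>: "\<sigma> \<in> states" for \<rho> \<sigma>
  proof
    assume "\<omega> \<in> open_segment \<rho> \<sigma>"
    then obtain u where "\<rho> \<noteq> \<sigma>" and u: "0 < u" "u < 1"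
      and comb: "\<omega> = (1 - u) *\<^sub>R \<rho> + u *\<^sub>R \<sigma>"
      by (auto simp: in_segment)
    have "\<rho> = \<omega>"
      by (rule character_eq_convex_part[OF \<omega> \<rho> \<sigma>, of "1 - u"])
         (use u comb in \<open>simp_all add: scaleR_fun_def scaleR_conv_of_real\<close>)
    moreover have "\<sigma> = \<omega>"
      by (rule character_eq_convex_part[OF \<omega> \<sigma> \<rho>, of u])
         (use u comb in \<open>simp_all add: scaleR_fun_def scaleR_conv_of_real\<close>)
    ultimately show False
      using \<open>\<rho> \<noteq> \<sigma>\<close> by simp
  qed
  with \<omega> show "\<omega> \<in> pure_states"
    by (auto simp: pure_states_def extreme_point_of_def characters_def)
qed

section \<open>Pure states are multiplicative\<close>

lemma normalize_state:
  assumes "\<rho> \<in> \<Omega> \<inter> dual_pos" "\<rho> 1 = of_real t" "0 < t"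
  shows "scaleC_functional (of_real (1 / t)) \<rho> \<in> states"
  using assms functional.subspace_scale[OF Omega_subspace] dual_pos_scale[of \<rho> "1 / t"]
  by (simp add: states_def) (simp add: scaleC_functional_def)

text \<open>Purity in its order-theoretic form. A summand of mass 0 or 1 cannot be normalized together
  with its complement; in these cases the summand of mass 0 vanishes by Cauchy-Schwarz.\<close>

lemma pure_summand_proportional:
  assumes pure: "\<omega> \<in> pure_states"
    and \<rho>: "\<rho> \<in> \<Omega> \<inter> dual_pos" and \<sigma>: "\<sigma> \<in> \<Omega> \<inter> dual_pos" and sum: "\<omega> = \<rho> + \<sigma>"
  shows "\<rho> b = \<rho> 1 * \<omega> b"
proof -
  have \<omega>: "\<omega> \<in> states"
    and ext: "\<And>f g. f \<in> states \<Longrightarrow> g \<in> states \<Longrightarrow> \<omega> \<notin> open_segment f g"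
    using pure by (auto simp: pure_states_def extreme_point_of_def)
  define t where "t = Re (\<rho> 1)"
  have \<rho>1: "\<rho> 1 = of_real t"
    unfolding t_def using dual_herm_real dual_posD(2) herm_one \<rho> by blast
  moreover have "\<rho> 1 + \<sigma> 1 = 1"
    using statesD(4)[OF \<omega>] sum by simp
  ultimately have \<sigma>1: "\<sigma> 1 = of_real (1 - t)"
    by (simp add: algebra_simps)
  have "0 \<le> \<rho> 1" "0 \<le> \<sigma> 1"
    using dual_posD(3)[OF _ one_pos] \<rho> \<sigma> by auto
  then have "0 \<le> t" "t \<le> 1"
    by (auto simp: \<rho>1 \<sigma>1 less_eq_complex_def)
  then consider "t = 0" | "t = 1" | "0 < t" "t < 1"
    by linarith
  then show ?thesis
  proof cases
    case 1
    then have "\<rho> = 0"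
      using dual_pos_eq_zero \<rho> \<rho>1 by auto
    then show ?thesis by simp
  next
    case 2
    then have "\<sigma> = 0"
      using dual_pos_eq_zero \<sigma> \<sigma>1 by auto
    then show ?thesis
      using sum \<rho>1 2 by simp
  next
    case 3
    let ?\<rho> = "scaleC_functional (of_real (1 / t)) \<rho>"
    let ?\<sigma> = "scaleC_functional (of_real (1 / (1 - t))) \<sigma>"
    have "?\<rho> \<in> states" "?\<sigma> \<in> states"
      using normalize_state[OF \<rho> \<rho>1] normalize_state[OF \<sigma> \<sigma>1] 3 by simp_all
    then have "\<omega> \<notin> open_segment ?\<sigma> ?\<rho>"
      by (intro ext)
    moreover have "of_real (1 - t) \<noteq> (0::complex)"
      using 3 by (simp only: of_real_eq_0_iff)
    then have comb: "\<omega> = (1 - t) *\<^sub>R ?\<sigma> + t *\<^sub>R ?\<rho>"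
      using 3 by (simp add: sum fun_eq_iff scaleR_fun_def scaleC_functional_def
          scaleR_conv_of_real add.commute)
    ultimately have "?\<sigma> = ?\<rho>"
      using 3 by (auto simp: in_segment)
    then have "\<omega> = ?\<rho>"
      using comb by (simp flip: scaleR_left_distrib)
    then have "\<omega> b = of_real (1 / t) * \<rho> b"
      by (simp add: fun_eq_iff scaleC_functional_def)
    with 3 \<rho>1 show ?thesis
      by simp
  qed
qed

text \<open>By commutativity, writing \<open>\<omega> ((star c * c + star d * d) * b)\<close> as \<open>\<omega> (star c * b * c) + \<omega> (star d * b * d)\<close>
  shows positivity and membership in the bimodule \<open>\<Omega>\<close>.\<close>

lemma sum_of_squares_mult_positive:
  assumes comm: "\<And>a b :: 'a. a * b = b * a"
    and \<omega>: "\<omega> \<in> \<Omega> \<inter> dual_pos" and p: "p = star c * c + star d * d"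
  shows "(\<lambda>b. \<omega> (p * b)) \<in> \<Omega> \<inter> dual_pos"
proof -
  have "\<omega> (p * b) = \<omega> (star c * b * c) + \<omega> (star d * b * d)" for b
  proof -
    have "p * b = star c * b * c + star d * b * d"
      by (simp add: p distrib_right mult.assoc comm[of b])
    then show ?thesis
      using dual_add[OF dual_posD(1)] \<omega> by simp
  qed
  then have "(\<lambda>b. \<omega> (p * b)) = dual_act c \<omega> (star c) + dual_act d \<omega> (star d)"
    by (simp add: fun_eq_iff dual_act_def)
  then show ?thesis
    using \<omega> dual_pos_conj dual_pos_add Omega_act functional.subspace_add[OF Omega_subspace] by simp
qed

lemma pure_mult_one_plus_square:
  assumes symm: symmetric and comm: "\<And>a b :: 'a. a * b = b * a"
    and pure: "\<omega> \<in> pure_states" and a: "a \<in> herm"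
  shows "\<omega> ((1 + a * a) * b) = \<omega> (1 + a * a) * \<omega> b"
proof -
  have \<omega>: "\<omega> \<in> states"
    using pure by (simp add: pure_states_def extreme_point_of_def)
  have lcomm: "x * (y * z) = y * (x * z)" for x y z :: 'a
    by (metis comm mult.assoc)
  note ac = mult.assoc comm lcomm
  obtain r where r: "(1 + a * a) * r = 1"
    using symm a by (auto simp: symmetric_def power2_eq_square)
  have star_a: "star a = a"
    using a by (simp add: herm_def)
  have star_r: "star r = r"
  proof -
    have "star r * (1 + a * a) = 1"
      using arg_cong[OF r, of star] by (simp add: star_mult star_add star_one star_a)
    then show ?thesis
      by (metis r mult.assoc mult_1_left mult_1_right)
  qed
  have r_add: "r + a * a * r = 1"
    using r by (simp add: distrib_right)
  have split: "x * r + x * (a * a * r) = x" for x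
    using arg_cong[OF r_add, of "(*) x"] by (simp add: distrib_left)
  have "r = star r * r + star (a * r) * (a * r)"
    using split[of r] by (simp add: star_mult star_r star_a ac)
  then have "(\<lambda>b. \<omega> (r * b)) \<in> \<Omega> \<inter> dual_pos"
    using statesD[OF \<omega>] by (intro sum_of_squares_mult_positive comm) auto
  moreover have "a * a * r = star (a * r) * (a * r) + star (a * a * r) * (a * a * r)"
    using split[of "a * a * r"] by (simp add: star_mult star_r star_a ac)
  then have "(\<lambda>b. \<omega> (a * a * r * b)) \<in> \<Omega> \<inter> dual_pos"
    using statesD[OF \<omega>] by (intro sum_of_squares_mult_positive comm) auto
  moreover have "\<omega> = (\<lambda>b. \<omega> (r * b)) + (\<lambda>b. \<omega> (a * a * r * b))"
    using r_add by (simp add: fun_eq_iff flip: dual_add[OF statesD(3)[OF \<omega>]] distrib_right)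
  ultimately have r_mult: "\<omega> (r * x) = \<omega> r * \<omega> x" for x
    using pure_summand_proportional[OF pure, of "\<lambda>b. \<omega> (r * b)" _ x] by simp
  have cancel: "r * ((1 + a * a) * x) = x" for x
    using r by (metis comm mult.assoc mult_1_left)
  have "1 = \<omega> r * \<omega> (1 + a * a)"
    using r_mult[of "1 + a * a"] cancel[of 1] statesD(4)[OF \<omega>] by simp
  moreover have "\<omega> b = \<omega> r * \<omega> ((1 + a * a) * b)"
    using r_mult[of "(1 + a * a) * b"] cancel[of b] by simp
  ultimately show ?thesis
    by (metis mult.assoc mult.commute mult_1_left)
qed

lemma pure_states_subset_characters:
  assumes symm: symmetric and comm: "\<And>a b :: 'a. a * b = b * a"
  shows "pure_states \<subseteq> characters"
proof
  fix \<omega> assume pure: "\<omega> \<in> pure_states"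
  then have \<omega>: "\<omega> \<in> states"
    by (simp add: pure_states_def extreme_point_of_def)
  note [simp] = dual_add[OF statesD(3)[OF \<omega>]] dual_scale[OF statesD(3)[OF \<omega>]] statesD(4)[OF \<omega>]
  have square: "\<omega> (a * a * b) = \<omega> (a * a) * \<omega> b" if "a \<in> herm" for a b
    using pure_mult_one_plus_square[OF symm comm pure that, of b] by (simp add: distrib_right)
  have herm: "\<omega> (a * b) = \<omega> a * \<omega> b" if a: "a \<in> herm" for a b
  proof -
    \<comment> \<open>\<open>2 * a = (a + 1) * (a + 1) - a * a - 1\<close> expresses \<open>a\<close> by squares.\<close>
    have "\<omega> ((a + 1) * (a + 1) * b) = \<omega> ((a + 1) * (a + 1)) * \<omega> b"
      by (intro square herm_add herm_one a)
    then show ?thesis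
      using square[OF a, of b] by (simp add: distrib_left distrib_right)
  qed
  have "\<omega> (a * b) = \<omega> a * \<omega> b" for a b
  proof -
    obtain h k where "h \<in> herm" "k \<in> herm" "a = h + \<i> *\<^sub>C k"
      by (rule cartesian_decomposition)
    then show ?thesis
      by (simp add: distrib_right scale_mult_left herm mult.assoc)
  qed
  with \<omega> show "\<omega> \<in> characters"
    by (simp add: characters_def)
qed

end

theorem theorem3p8:
  fixes scale :: "complex \<Rightarrow> 'a::{ring, monoid_mult} \<Rightarrow> 'a"
    and star :: "'a \<Rightarrow> 'a"
    and le :: "'a \<Rightarrow> 'a \<Rightarrow> bool"
    and \<Omega> :: "('a \<Rightarrow> complex) set"
  assumes "abstract_Ostar_algebra scale star le \<Omega>"
    and "abstract_Ostar_algebra.symmetric star"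
    and "\<forall>a b :: 'a. a * b = b * a"
  shows "abstract_Ostar_algebra.pure_states scale star le \<Omega>
       = abstract_Ostar_algebra.characters scale star le \<Omega>"
proof -
  interpret abstract_Ostar_algebra scale star le \<Omega>
    by (rule assms(1))
  show ?thesis
    using pure_states_subset_characters[OF assms(2)] characters_subset_pure_states assms(3)
    by blast
qed

end
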